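(* Consider a sequential decision process with finite tree of decision points $\mathcal{J}$ and decision sets $X_j$ ($j\in\mathcal{J}$), let $T\ge 1$, let $x^1,\dots,x^T\in X=\prod_{j\in\mathcal{J}}X_j$ be any strategies, and for each $t=1,\dots,T$ and $j\in\mathcal{J}$ let $\ell^t_j:X_j\to\mathbb{R}$ be a convex function. Then for every decision point $j\in\mathcal{J}$, the cumulative subtree regret $R^T_{\triangle_j}$ decomposes as $$R^T_{\triangle_j}=\sum_{t=1}^T \hat\ell^t_j(x^t_j)-\min_{\hat x_j\in X_j}\Big\{\sum_{t=1}^T\hat\ell^t_j(\hat x_j)-\sum_{a\in A_j}\sum_{j'\in\mathcal{C}_{j,a}}\hat x_{j,a}\,R^T_{\triangle_{j'}}\Big\}.$$
   Context: **Sequential decision process.** $\mathcal{J}$ is a finite set of decision points. Each $j\in\mathcal{J}$ has a finite action set $A_j$ with $|A_j|=n_j$ and a (nonempty) compact convex decision set $X_j\subseteq\Delta_{n_j}$, where $\Delta_{n_j}$ is the probability simplex over $A_j$; for $x_j\in X_j$, $x_{j,a}$ is the coordinate of action $a$. For $j\in\mathcal{J}$ and $a\in A_j$, $\mathcal{C}_{j,a}\subseteq\mathcal{J}$ is the (possibly empty) set of possible next decision points after taking action $a$ at $j$. The decision points form a tree with root $r$: the sets $\mathcal{C}_{j,a}$ are pairwise disjoint, and every $j'\neq r$ is reached from $r$ by a unique path. **Strategies.** $X=\prod_{j\in\mathcal{J}}X_j$. For $x\in X$, $x_j$ is its component in $X_j$, and $x_{\triangle_j}$ is the part of $x$ consisting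 of the components at $j$ and at all descendants of $j$. Thus $\hat x_{\triangle_j}$ ranges over the product of the sets $X_i$ over $i$ equal to $j$ or a descendant of $j$. **Values.** For each $t$ and $j$, recursively (from the leaves up) $$\hat V^t_{\triangle_j}(\hat x_{\triangle_j})=\ell^t_j(\hat x_j)+\sum_{a\in A_j}\sum_{j'\in\mathcal{C}_{j,a}}\hat x_{j,a}\,\hat V^t_{\triangle_{j'}}(\hat x_{\triangle_{j'}}),\qquad V^t_{\triangle_j}=\hat V^t_{\triangle_j}(x^t_{\triangle_j}).$$ **Cumulative subtree regret.** $$R^T_{\triangle_j}=\sum_{t=1}^T V^t_{\triangle_j}-\min_{\hat x_{\triangle_j}}\sum_{t=1}^T\hat V^t_{\triangle_j}(\hat x_{\triangle_j}).$$ **Local loss.** For $x_j\in X_j$, $$\hat\ell^t_j(x_j)=\ell^t_j(x_j)+\sum_{a\in A_j}\sum_{j'\in\mathcal{C}_{j,a}}x_{j,a}\,V^t_{\triangle_{j'}}.$$ Minima are read as infima if they are not attained. *)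

theory Defs
  imports "HOL-Analysis.Analysis"
begin

text \<open>
  Actions are drawn from one finite type, the action set of a decision point \<open>j\<close> being a
  subset \<open>A j\<close> of it.  A vector indexed by \<open>A j\<close> is an element of \<open>real ^ 'a\<close> that vanishes
  outside \<open>A j\<close>; on such vectors compactness and convexity mean the same as in the
  Euclidean space of dimension \<open>card (A j)\<close>.
\<close>

definition simplex_on :: "'a::finite set \<Rightarrow> (real ^ 'a) set" where
  "simplex_on S = {v. (\<forall>a. 0 \<le> v $ a) \<and> (\<forall>a. a \<notin> S \<longrightarrow> v $ a = 0) \<and> (\<Sum>a\<in>S. v $ a) = 1}"

definition child_rel :: "'j set \<Rightarrow> ('j \<Rightarrow> 'a set) \<Rightarrow> ('j \<Rightarrow> 'a \<Rightarrow> 'j set) \<Rightarrow> ('j \<times> 'j) set" where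
  "child_rel J A C = {(i, j). i \<in> J \<and> (\<exists>a\<in>A i. j \<in> C i a)}"

definition is_path :: "('j \<times> 'j) set \<Rightarrow> 'j \<Rightarrow> 'j list \<Rightarrow> 'j \<Rightarrow> bool" where
  "is_path E i p j \<longleftrightarrow>
     p \<noteq> [] \<and> hd p = i \<and> last p = j \<and> successively (\<lambda>u v. (u, v) \<in> E) p"

locale sdp =
  fixes J :: "'j set"
    and r :: 'j
    and A :: "'j \<Rightarrow> 'a::finite set"
    and C :: "'j \<Rightarrow> 'a \<Rightarrow> 'j set"
    and X :: "'j \<Rightarrow> (real ^ 'a) set"
  assumes finite_J: "finite J"
    and root_in: "r \<in> J"
    and children_in: "\<And>j a. j \<in> J \<Longrightarrow> a \<in> A j \<Longrightarrow> C j a \<subseteq> J"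
    and children_disjoint:
      "\<And>i a j b. i \<in> J \<Longrightarrow> a \<in> A i \<Longrightarrow> j \<in> J \<Longrightarrow> b \<in> A j \<Longrightarrow> (i, a) \<noteq> (j, b) \<Longrightarrow>
         C i a \<inter> C j b = {}"
    and root_no_parent: "\<And>j a. j \<in> J \<Longrightarrow> a \<in> A j \<Longrightarrow> r \<notin> C j a"
    and unique_path: "\<And>j. j \<in> J \<Longrightarrow> j \<noteq> r \<Longrightarrow> \<exists>!p. is_path (child_rel J A C) r p j"
    and decisions_nonempty: "\<And>j. j \<in> J \<Longrightarrow> X j \<noteq> {}"
    and decisions_compact: "\<And>j. j \<in> J \<Longrightarrow> compact (X j)"
    and decisions_convex: "\<And>j. j \<in> J \<Longrightarrow> convex (X j)"
    and decisions_simplex: "\<And>j. j \<in> J \<Longrightarrow> X j \<subseteq> simplex_on (A j)"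
begin

definition subtree :: "'j \<Rightarrow> 'j set" where
  "subtree j = {i. (j, i) \<in> (child_rel J A C)\<^sup>*}"

lemma rtrancl_path:
  assumes "(i, j) \<in> E\<^sup>*"
  shows "\<exists>p. is_path E i p j"
  using assms
proof (induction rule: rtrancl_induct)
  case base
  have "is_path E i [i] i" by (simp add: is_path_def)
  then show ?case ..
next
  case (step k l)
  then obtain p where p: "is_path E i p k" by blast
  have "is_path E i (p @ [l]) l"
    using p step.hyps(2) by (auto simp: is_path_def successively_append_iff)
  then show ?case ..
qed

lemma not_ancestor_of_itself:
  assumes "i \<in> J" and "(i, j) \<in> child_rel J A C"
  shows "(j, i) \<notin> (child_rel J A C)\<^sup>*"
proof
  let ?E = "child_rel J A C"
  assume ret: "(j, i) \<in> ?E\<^sup>*"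
  show False
  proof (cases "i = r")
    case True
    have "(i, i) \<in> ?E\<^sup>+" using assms(2) ret by (rule rtrancl_into_trancl2)
    then obtain k where "(k, r) \<in> ?E" using True by (meson tranclE)
    then show False using root_no_parent by (auto simp: child_rel_def)
  next
    case False
    obtain p where p: "is_path ?E r p i" using unique_path[OF assms(1) False] by blast
    obtain q where q: "is_path ?E j q i" using rtrancl_path[OF ret] by blast
    have "is_path ?E r (p @ q) i"
      using p q assms(2) by (auto simp: is_path_def successively_append_iff)
    then have "p @ q = p" using unique_path[OF assms(1) False] p by blast
    then show False using q by (simp add: is_path_def)
  qed
qed

lemma subtree_subset: "j \<in> J \<Longrightarrow> subtree j \<subseteq> J"
proof
  fix i assume "j \<in> J" "i \<in> subtree j"
  then have "(j, i) \<in> (child_rel J A C)\<^sup>*" by (simp add: subtree_def)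
  then show "i \<in> J"
    using \<open>j \<in> J\<close> children_in by (induction rule: rtrancl_induct) (auto simp: child_rel_def)
qed

lemma card_subtree_less:
  assumes "j \<in> J" "a \<in> A j" "k \<in> C j a"
  shows "card (subtree k) < card (subtree j)"
proof (rule psubset_card_mono)
  have e: "(j, k) \<in> child_rel J A C" using assms by (auto simp: child_rel_def)
  show "finite (subtree j)" using subtree_subset[OF assms(1)] finite_J by (rule finite_subset)
  have "subtree k \<subseteq> subtree j"
    using e by (auto simp: subtree_def intro: converse_rtrancl_into_rtrancl)
  moreover have "j \<in> subtree j" by (simp add: subtree_def)
  moreover have "j \<notin> subtree k"
    using not_ancestor_of_itself[OF assms(1) e] by (simp add: subtree_def)
  ultimately show "subtree k \<subset> subtree j" by blast
qed

text \<open>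
  The argument \<open>loss\<close> is the loss family of a single round, and \<open>y\<close> is a profile of which only
  the components in \<open>subtree j\<close> matter.  The value off \<open>J\<close> is a dummy.
\<close>

function value_hat :: "('j \<Rightarrow> real ^ 'a \<Rightarrow> real) \<Rightarrow> ('j \<Rightarrow> real ^ 'a) \<Rightarrow> 'j \<Rightarrow> real" where
  "value_hat loss y j =
     (if j \<in> J
      then loss j (y j) + (\<Sum>a\<in>A j. \<Sum>k\<in>C j a. y j $ a * value_hat loss y k)
      else 0)"
  by pat_completeness auto
termination
  by (relation "Wellfounded.measure (\<lambda>(loss, y, j). card (subtree j))") (auto intro: card_subtree_less)

declare value_hat.simps [simp del]

definition subtree_value :: "('j \<Rightarrow> real ^ 'a \<Rightarrow> real) \<Rightarrow> ('j \<Rightarrow> real ^ 'a) \<Rightarrow> 'j \<Rightarrow> real" where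
  "subtree_value loss x j = value_hat loss (restrict x (subtree j)) j"

text \<open>
  The minima are infima.  They are taken over nonempty sets of reals that are bounded below
  when the losses are convex, since a convex function on a compact convex subset of a
  Euclidean space is bounded below.
\<close>

definition subtree_regret ::
    "nat \<Rightarrow> (nat \<Rightarrow> 'j \<Rightarrow> real ^ 'a \<Rightarrow> real) \<Rightarrow> (nat \<Rightarrow> 'j \<Rightarrow> real ^ 'a) \<Rightarrow> 'j \<Rightarrow> real" where
  "subtree_regret T loss x j =
     (\<Sum>t=1..T. subtree_value (loss t) (x t) j)
     - (INF y\<in>(\<Pi>\<^sub>E i\<in>subtree j. X i). \<Sum>t=1..T. value_hat (loss t) y j)"

definition local_loss ::
    "('j \<Rightarrow> real ^ 'a \<Rightarrow> real) \<Rightarrow> ('j \<Rightarrow> real ^ 'a) \<Rightarrow> 'j \<Rightarrow> real ^ 'a \<Rightarrow> real" where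
  "local_loss loss x j v = loss j v + (\<Sum>a\<in>A j. \<Sum>k\<in>C j a. v $ a * subtree_value loss x k)"

end

end

theory Submission
  imports Defs
begin

text \<open>
  Writing \<open>W k\<close> for the optimal cumulative value of the subtree at \<open>k\<close>, the claim reduces to the
  Bellman recursion
  \<open>W j = inf\<^sub>v (\<Sum>\<^sub>t \<ell>\<^sub>j\<^sup>t(v) + \<Sum>\<^sub>a \<Sum>\<^sub>k v\<^sub>a W k)\<close>.  One inequality uses \<open>v\<^sub>a \<ge> 0\<close>; the
  other glues near-optimal profiles on the subtrees of the children, which are disjoint.  Convexity
  of the losses enters only through boundedness from below, which keeps the infima meaningful.
\<close>

section \<open>Lower bounds of convex functions and near-minimisers\<close>

text \<open>A convex function may be discontinuous at the relative boundary, so compactness alone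
  gives no minimum. Instead, a simplex inside \<open>S\<close> bounds \<open>f\<close> above by its
  vertex values, and convexity along lines through a relatively interior point \<open>c\<close>
  turns this upper bound into a lower one.\<close>

lemma convex_on_bounded_imp_bdd_below:
  fixes f :: "'v::euclidean_space \<Rightarrow> real"
  assumes "convex_on S f" "bounded S"
  shows "bdd_below (f ` S)"
proof (cases "S = {}")
  case False
  have "convex S" using assms(1) by (rule convex_on_imp_convex)
  \<comment> \<open>The simplex with vertices \<open>B\<close> has the same affine hull as
    \<open>S\<close>, so a ball around \<open>c\<close> relative to that hull fits inside
    it.\<close>
  obtain B where B: "B \<subseteq> S" "\<not> affine_dependent B" "affine hull S = affine hull B"
    using affine_basis_exists by metis
  have "finite B" using B(2) by (rule aff_independent_finite)
  have "B \<noteq> {}" using B(3) False by auto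
  have hull: "convex hull B \<subseteq> S" using B(1) \<open>convex S\<close> by (rule hull_minimal)
  have "rel_interior (convex hull B) \<noteq> {}"
    using \<open>B \<noteq> {}\<close> by (simp add: rel_interior_eq_empty)
  then obtain c d where c: "c \<in> convex hull B" and d: "d > 0"
    and cd: "cball c d \<inter> affine hull B \<subseteq> convex hull B"
    unfolding mem_rel_interior_cball by (auto simp: rel_interior_cball)
  define M where "M = Max (f ` B)"
  have M: "f z \<le> M" if "z \<in> convex hull B" for z
  proof -
    have "\<forall>b\<in>B. f b \<le> M" using \<open>finite B\<close> by (simp add: M_def)
    then show ?thesis
      using convex_on_convex_hull_bound[OF convex_on_subset[OF assms(1) hull]] that
      by (simp add: convex_convex_hull)
  qed
  obtain D where D: "D > 0" "\<And>y. y \<in> S \<Longrightarrow> norm (y - c) \<le> D"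
  proof -
    obtain K where "\<And>y. y \<in> S \<Longrightarrow> norm y \<le> K" using assms(2) by (auto simp: bounded_iff)
    then have "norm (y - c) \<le> \<bar>K\<bar> + norm c + 1" if "y \<in> S" for y
      using that norm_triangle_ineq4[of y c] by force
    then show thesis using that[of "\<bar>K\<bar> + norm c + 1"] by (simp add: add_nonneg_pos)
  qed
  \<comment> \<open>This ratio keeps every reflected point within distance \<open>d\<close> of
    \<open>c\<close>, uniformly in \<open>y\<close>.\<close>
  define e where "e = d / D"
  have e: "e > 0" using d D(1) by (simp add: e_def)
  \<comment> \<open>The constant comes from solving \<open>(1 + e) * f c \<le> M + e * f y\<close>
    for \<open>f y\<close>.\<close>
  have "((1 + e) * f c - M) / e \<le> f y" if y: "y \<in> S" for y
  proof -
    \<comment> \<open>\<open>c\<close> lies between \<open>y\<close> and the reflected point \<open>z\<close>, at which \<open>f\<close> is at most \<open>M\<close>.\<close>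
    define z where "z = (1 + e) *\<^sub>R c + (- e) *\<^sub>R y"
    have "y \<in> affine hull B" "c \<in> affine hull B"
      using y B(3) hull_inc[of y S] c convex_hull_subset_affine_hull[of B] by auto
    then have "z \<in> affine hull B"
      unfolding z_def by (intro mem_affine) (auto simp: affine_affine_hull)
    moreover have "c - z = e *\<^sub>R (y - c)" by (simp add: z_def algebra_simps)
    then have "dist c z = e * norm (y - c)" using e by (simp add: dist_norm)
    moreover have "e * norm (y - c) \<le> d"
      using mult_left_mono[OF D(2)[OF y], of e] e D(1) by (simp add: e_def)
    ultimately have z: "z \<in> convex hull B" using cd by auto
    have "c = (1 / (1 + e)) *\<^sub>R z + (e / (1 + e)) *\<^sub>R y"
      using e by (simp add: z_def scaleR_diff_right)
    moreover have "1 / (1 + e) + e / (1 + e) = 1" using e by (simp add: field_simps)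
    ultimately have "f c \<le> 1 / (1 + e) * f z + e / (1 + e) * f y"
      using assms(1) e z hull y unfolding convex_on_def
      by (smt (verit, best) divide_nonneg_nonneg subsetD)
    also have "\<dots> \<le> 1 / (1 + e) * M + e / (1 + e) * f y"
      using M[OF z] e by (intro add_right_mono mult_left_mono) auto
    also have "\<dots> = (M + e * f y) / (1 + e)" by (simp add: add_divide_distrib)
    finally show ?thesis using e by (simp add: field_simps)
  qed
  then show ?thesis by (intro bdd_belowI2)
qed simp

lemma INF_ex_less:
  fixes f :: "'b \<Rightarrow> real"
  assumes "S \<noteq> {}" "e > 0"
  shows "\<exists>y\<in>S. f y < (INF z\<in>S. f z) + e"
proof -
  have "\<exists>a\<in>f ` S. a < Inf (f ` S) + e" using assms by (intro cInf_lessD) auto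
  then show ?thesis by blast
qed

context sdp
begin

section \<open>Tree structure of the subtrees\<close>

lemma self_in_subtree: "j \<in> subtree j"
  by (simp add: subtree_def)

lemma subtree_child:
  assumes "j \<in> J" "a \<in> A j" "k \<in> C j a"
  shows "subtree k \<subseteq> subtree j"
  using assms
  by (auto simp: subtree_def child_rel_def intro: converse_rtrancl_into_rtrancl)

lemma not_in_subtree_child:
  assumes "j \<in> J" "a \<in> A j" "k \<in> C j a"
  shows "j \<notin> subtree k"
  using not_ancestor_of_itself[OF assms(1), of k] assms by (auto simp: subtree_def child_rel_def)

lemma in_subtree_cases:
  assumes "i \<in> subtree j"
  obtains "i = j" | a k where "a \<in> A j" "k \<in> C j a" "i \<in> subtree k"
  using assms unfolding subtree_def child_rel_def by (auto elim: converse_rtranclE)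

lemma parent_unique:
  assumes "(i, k) \<in> child_rel J A C" "(j, k) \<in> child_rel J A C"
  shows "i = j"
  using assms children_disjoint unfolding child_rel_def by blast

text \<open>Parents are unique, so the ancestors of a node form a chain. Two children of
  \<open>j\<close> with a common descendant would be comparable, which forces a cycle through
  \<open>j\<close>.\<close>

lemma subtree_children_disjoint:
  assumes "j \<in> J" "a \<in> A j" "k \<in> C j a" "b \<in> A j" "l \<in> C j b" "k \<noteq> l"
  shows "subtree k \<inter> subtree l = {}"
proof -
  let ?E = "child_rel J A C"
  \<comment> \<open>The last edge into \<open>w\<close> starts at its only parent \<open>j\<close>,
    so \<open>j\<close> would lie below its own child \<open>u\<close>.\<close>
  have *: False if uw: "(u, w) \<in> ?E\<^sup>*" "u \<noteq> w" and ju: "(j, u) \<in> ?E" and jw: "(j, w) \<in> ?E" for u w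
  proof -
    obtain p where "(u, p) \<in> ?E\<^sup>*" "(p, w) \<in> ?E" using uw by (auto elim: rtranclE)
    then have "(u, j) \<in> ?E\<^sup>*" using parent_unique jw by blast
    then show False using not_ancestor_of_itself[OF assms(1) ju] by blast
  qed
  have "(j, k) \<in> ?E" "(j, l) \<in> ?E" using assms by (auto simp: child_rel_def)
  moreover have "(k, l) \<in> ?E\<^sup>* \<or> (l, k) \<in> ?E\<^sup>*"
    if "(k, i) \<in> ?E\<^sup>*" "(l, i) \<in> ?E\<^sup>*" for i
  proof -
    have "single_valued (?E\<inverse>)" using parent_unique by (auto intro: single_valuedI)
    moreover have "(i, k) \<in> (?E\<inverse>)\<^sup>*" "(i, l) \<in> (?E\<inverse>)\<^sup>*"
      using that by (auto intro: rtrancl_converseI)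
    ultimately show ?thesis
      using single_valued_confluent rtrancl_converseD by metis
  qed
  ultimately show ?thesis using * assms(6) by (fastforce simp: subtree_def)
qed

section \<open>Locality and boundedness of subtree values\<close>

lemma decision_bounds:
  assumes "j \<in> J" "v \<in> X j"
  shows "0 \<le> v $ a" "v $ a \<le> 1"
proof -
  have v: "\<And>a. 0 \<le> v $ a" "\<And>a. a \<notin> A j \<Longrightarrow> v $ a = 0" "(\<Sum>a\<in>A j. v $ a) = 1"
    using decisions_simplex[OF assms(1)] assms(2) by (auto simp: simplex_on_def)
  then show "0 \<le> v $ a" by blast
  show "v $ a \<le> 1"
    using v member_le_sum[of a "A j" "\<lambda>a. v $ a"] by (cases "a \<in> A j") auto
qed

lemma value_hat_cong:
  "(\<And>i. i \<in> subtree j \<Longrightarrow> y i = z i) \<Longrightarrow> value_hat loss y j = value_hat loss z j"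
proof (induction loss y j rule: value_hat.induct)
  case (1 loss y j)
  show ?case
  proof (cases "j \<in> J")
    case True
    have "value_hat loss y k = value_hat loss z k" if "a \<in> A j" "k \<in> C j a" for a k
      using that True subtree_child[OF True that] 1 by blast
    moreover have "y j = z j" using 1(2) self_in_subtree by blast
    ultimately show ?thesis by (simp add: value_hat.simps[of _ _ j])
  qed (simp add: value_hat.simps)
qed

lemma restrict_subtree_PiE:
  assumes "j \<in> J" "a \<in> A j" "k \<in> C j a" "y \<in> (\<Pi>\<^sub>E i\<in>subtree j. X i)"
  shows "restrict y (subtree k) \<in> (\<Pi>\<^sub>E i\<in>subtree k. X i)"
  using assms(4) subtree_child[OF assms(1-3)] by auto

text \<open>At the played decision the local loss is exactly the recursion for the value, so the
  first sum in the claim is the cumulative value itself.\<close>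

lemma subtree_value_unfold:
  assumes "j \<in> J"
  shows "subtree_value loss x j = local_loss loss x j (x j)"
proof -
  have "value_hat loss (restrict x (subtree j)) k = subtree_value loss x k"
    if "a \<in> A j" "k \<in> C j a" for a k
    unfolding subtree_value_def
    using subtree_child[OF assms that] by (intro value_hat_cong) auto
  then show ?thesis
    unfolding local_loss_def
    by (subst subtree_value_def) (simp add: value_hat.simps[of _ _ j] assms self_in_subtree)
qed

lemma PiE_subtree_nonempty: "j \<in> J \<Longrightarrow> (\<Pi>\<^sub>E i\<in>subtree j. X i) \<noteq> {}"
  using subtree_subset decisions_nonempty by (auto simp: PiE_eq_empty_iff)

lemma value_hat_bdd_below:
  assumes "\<And>i. i \<in> J \<Longrightarrow> bdd_below (loss i ` X i)" "j \<in> J"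
  shows "bdd_below ((\<lambda>y. value_hat loss y j) ` (\<Pi>\<^sub>E i\<in>subtree j. X i))"
  using assms(2)
proof (induction "card (subtree j)" arbitrary: j rule: less_induct)
  case less
  have "\<forall>k\<in>(\<Union>a\<in>A j. C j a).
      \<exists>m. \<forall>y\<in>(\<Pi>\<^sub>E i\<in>subtree k. X i). m \<le> value_hat loss y k"
  proof
    fix k assume "k \<in> (\<Union>a\<in>A j. C j a)"
    then obtain a where k: "a \<in> A j" "k \<in> C j a" by blast
    then have "k \<in> J" using children_in[OF less(2)] by blast
    from less(1)[OF card_subtree_less[OF less(2) k] this]
    show "\<exists>m. \<forall>y\<in>(\<Pi>\<^sub>E i\<in>subtree k. X i). m \<le> value_hat loss y k"
      by (auto simp: bdd_below_def)
  qed
  from bchoice[OF this] obtain m where m: "\<And>a k y. a \<in> A j \<Longrightarrow> k \<in> C j a \<Longrightarrow>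
      y \<in> (\<Pi>\<^sub>E i\<in>subtree k. X i) \<Longrightarrow> m k \<le> value_hat loss y k"
    by blast
  obtain m0 where m0: "\<And>v. v \<in> X j \<Longrightarrow> m0 \<le> loss j v"
    using assms(1)[OF less(2)] by (auto simp: bdd_below_def)
  \<comment> \<open>The sign of \<open>m k\<close> is unknown and its weight can be anything in
    [0,1]; the absolute value covers all cases.\<close>
  have "m0 + (\<Sum>a\<in>A j. \<Sum>k\<in>C j a. - \<bar>m k\<bar>) \<le> value_hat loss y j"
    if y: "y \<in> (\<Pi>\<^sub>E i\<in>subtree j. X i)" for y
  proof -
    have yj: "y j \<in> X j" using y self_in_subtree by auto
    have "- \<bar>m k\<bar> \<le> y j $ a * value_hat loss y k" if "a \<in> A j" "k \<in> C j a" for a k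
    proof -
      have "value_hat loss y k = value_hat loss (restrict y (subtree k)) k"
        by (intro value_hat_cong) auto
      then have "m k \<le> value_hat loss y k"
        using m[OF that restrict_subtree_PiE[OF less(2) that y]] by simp
      then have "y j $ a * (- \<bar>m k\<bar>) \<le> y j $ a * value_hat loss y k"
        using decision_bounds(1)[OF less(2) yj] by (intro mult_left_mono) auto
      moreover have "y j $ a * \<bar>m k\<bar> \<le> 1 * \<bar>m k\<bar>"
        using decision_bounds(2)[OF less(2) yj] by (intro mult_right_mono) auto
      ultimately show ?thesis by simp
    qed
    then show ?thesis
      using m0[OF yj] less(2)
      by (simp add: value_hat.simps[of _ _ j] del: sum_negf) (intro add_mono sum_mono; simp)
  qed
  then show ?case by (intro bdd_belowI2)
qed

section \<open>Bellman recursion for the best fixed profile in hindsight\<close>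

definition optimal_value :: "nat \<Rightarrow> (nat \<Rightarrow> 'j \<Rightarrow> real ^ 'a \<Rightarrow> real) \<Rightarrow> 'j \<Rightarrow> real" where
  "optimal_value T loss j =
     (INF y\<in>(\<Pi>\<^sub>E i\<in>subtree j. X i). \<Sum>t=1..T. value_hat (loss t) y j)"

lemma sum_value_hat_unfold:
  assumes "j \<in> J"
  shows "(\<Sum>t=1..T::nat. value_hat (loss t) y j) =
    (\<Sum>t=1..T. loss t j (y j)) +
    (\<Sum>a\<in>A j. \<Sum>k\<in>C j a. y j $ a * (\<Sum>t=1..T. value_hat (loss t) y k))"
proof -
  have "(\<Sum>t=1..T. \<Sum>a\<in>A j. \<Sum>k\<in>C j a. y j $ a * value_hat (loss t) y k) =
      (\<Sum>a\<in>A j. \<Sum>t=1..T. \<Sum>k\<in>C j a. y j $ a * value_hat (loss t) y k)"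
    by (rule sum.swap)
  also have "\<dots> = (\<Sum>a\<in>A j. \<Sum>k\<in>C j a. \<Sum>t=1..T. y j $ a * value_hat (loss t) y k)"
    by (intro sum.cong refl sum.swap)
  finally show ?thesis
    using assms by (simp add: value_hat.simps[of _ _ j] sum.distrib sum_distrib_left)
qed

text \<open>The profiles below different children can be chosen independently of each other and of
  \<open>v\<close>. This is what allows the infimum to pass through the sum over children.\<close>

lemma glue_children:
  assumes "j \<in> J" "v \<in> X j"
    and w: "\<And>a k. a \<in> A j \<Longrightarrow> k \<in> C j a \<Longrightarrow> w k \<in> (\<Pi>\<^sub>E i\<in>subtree k. X i)"
  obtains y where "y \<in> (\<Pi>\<^sub>E i\<in>subtree j. X i)" "y j = v"
    "\<And>a k i. a \<in> A j \<Longrightarrow> k \<in> C j a \<Longrightarrow> i \<in> subtree k \<Longrightarrow> y i = w k i"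
proof
  \<comment> \<open>For \<open>i\<close> strictly below \<open>j\<close>, this is the child of
    \<open>j\<close> whose subtree contains \<open>i\<close>; disjointness makes the choice
    unique.\<close>
  define par where "par i = (SOME k. \<exists>a\<in>A j. k \<in> C j a \<and> i \<in> subtree k)" for i
  define y where "y = (\<lambda>i\<in>subtree j. if i = j then v else w (par i) i)"
  have par: "par i = k" if "a \<in> A j" "k \<in> C j a" "i \<in> subtree k" for a k i
    unfolding par_def
  proof (rule some_equality)
    show "\<exists>a\<in>A j. k \<in> C j a \<and> i \<in> subtree k" using that by blast
  next
    fix l assume "\<exists>b\<in>A j. l \<in> C j b \<and> i \<in> subtree l"
    then show "l = k" using subtree_children_disjoint[OF assms(1)] that by blast
  qed
  show child: "y i = w k i" if "a \<in> A j" "k \<in> C j a" "i \<in> subtree k" for a k i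
    using that par[OF that] subtree_child[OF assms(1) that(1,2)]
      not_in_subtree_child[OF assms(1) that(1,2)]
    by (auto simp: y_def)
  show yj: "y j = v" by (simp add: y_def self_in_subtree)
  have "y i \<in> X i" if "i \<in> subtree j" for i
    using that
  proof (cases rule: in_subtree_cases)
    case 1
    then show ?thesis using yj assms(2) by simp
  next
    case (2 a k)
    then show ?thesis using child[OF 2] w[OF 2(1,2)] by auto
  qed
  then show "y \<in> (\<Pi>\<^sub>E i\<in>subtree j. X i)" by (auto simp: y_def)
qed

lemma optimal_value_recursion:
  assumes bdd: "\<And>t i. t \<in> {1..T} \<Longrightarrow> i \<in> J \<Longrightarrow> bdd_below (loss t i ` X i)"
    and j: "j \<in> J"
  shows "optimal_value T loss j =
    (INF v\<in>X j. (\<Sum>t=1..T. loss t j v) +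
      (\<Sum>a\<in>A j. \<Sum>k\<in>C j a. v $ a * optimal_value T loss k))"
    (is "_ = (INF v\<in>X j. ?g v)")
proof -
  let ?P = "\<lambda>j. \<Pi>\<^sub>E i\<in>subtree j. X i"
  let ?F = "\<lambda>y j. \<Sum>t=1..T. value_hat (loss t) y j"
  \<comment> \<open>Real infima are bounded by members only for sets bounded below; the bounds of
    the single rounds add up.\<close>
  have bddF: "bdd_below ((\<lambda>y. ?F y i) ` ?P i)" if "i \<in> J" for i
  proof -
    have "\<exists>m. \<forall>y\<in>?P i. m \<le> value_hat (loss t) y i" if "t \<in> {1..T}" for t
      using value_hat_bdd_below[OF bdd \<open>i \<in> J\<close>] that by (auto simp: bdd_below_def)
    then obtain m where "\<And>t y. t \<in> {1..T} \<Longrightarrow> y \<in> ?P i \<Longrightarrow> m t \<le> value_hat (loss t) y i"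
      by metis
    then show ?thesis by (intro bdd_belowI2[where m = "\<Sum>t=1..T. m t"] sum_mono)
  qed
  have child: "k \<in> J" if "a \<in> A j" "k \<in> C j a" for a k
    using children_in[OF j that(1)] that(2) by blast
  have lower: "?g (y j) \<le> ?F y j" if y: "y \<in> ?P j" for y
  proof -
    have "optimal_value T loss k \<le> ?F y k" if "a \<in> A j" "k \<in> C j a" for a k
    proof -
      have "?F y k = ?F (restrict y (subtree k)) k"
        by (intro sum.cong refl value_hat_cong) auto
      then show ?thesis
        unfolding optimal_value_def
        using cINF_lower[OF bddF[OF child[OF that]] restrict_subtree_PiE[OF j that y]] by simp
    qed
    moreover have "y j \<in> X j" using y self_in_subtree by auto
    ultimately show ?thesis
      unfolding sum_value_hat_unfold[OF j]
      by (intro add_left_mono sum_mono mult_left_mono decision_bounds(1)[OF j])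
  qed
  have upper: "optimal_value T loss j \<le> ?g v" if v: "v \<in> X j" for v
  proof (rule field_le_epsilon)
    fix e :: real assume "e > 0"
    define N where "N = (\<Sum>a\<in>A j. \<Sum>k\<in>C j a. v $ a)"
    have N: "N \<ge> 0" unfolding N_def by (intro sum_nonneg decision_bounds(1)[OF j v])
    \<comment> \<open>A slack of \<open>d\<close> per child costs \<open>N * d\<close> in total
      after weighting. The added 1 avoids division by zero when \<open>N\<close> is 0, for instance
      at a leaf.\<close>
    define d where "d = e / (N + 1)"
    have d: "d > 0" "N * d \<le> e" using \<open>e > 0\<close> N by (auto simp: d_def field_simps)
    have "\<forall>k\<in>J. \<exists>y. y \<in> ?P k \<and> ?F y k < optimal_value T loss k + d"
      unfolding optimal_value_def Bex_def[symmetric]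
      by (intro ballI INF_ex_less PiE_subtree_nonempty d(1))
    from bchoice[OF this] obtain w where w: "\<And>k. k \<in> J \<Longrightarrow> w k \<in> ?P k"
        "\<And>k. k \<in> J \<Longrightarrow> ?F (w k) k < optimal_value T loss k + d"
      by blast
    obtain y where y: "y \<in> ?P j" "y j = v"
        "\<And>a k i. a \<in> A j \<Longrightarrow> k \<in> C j a \<Longrightarrow> i \<in> subtree k \<Longrightarrow> y i = w k i"
      using glue_children[OF j v, of w] w(1) child by blast
    have Fy: "?F y k \<le> optimal_value T loss k + d" if "a \<in> A j" "k \<in> C j a" for a k
    proof -
      have "?F y k = ?F (w k) k"
        using y(3)[OF that] by (intro sum.cong refl value_hat_cong) auto
      then show ?thesis using w(2)[OF child[OF that]] by simp
    qed
    have "optimal_value T loss j \<le> ?F y j"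
      unfolding optimal_value_def using bddF[OF j] y(1) by (rule cINF_lower)
    also have "\<dots> \<le> (\<Sum>t=1..T. loss t j v) +
        (\<Sum>a\<in>A j. \<Sum>k\<in>C j a. v $ a * (optimal_value T loss k + d))"
      unfolding sum_value_hat_unfold[OF j] y(2)
      by (intro add_left_mono sum_mono mult_left_mono Fy decision_bounds(1)[OF j v])
    also have "\<dots> = ?g v + N * d"
      by (simp add: N_def distrib_left sum.distrib sum_distrib_right mult.assoc)
    finally show "optimal_value T loss j \<le> ?g v + e" using d(2) by simp
  qed
  show ?thesis
  proof (rule antisym)
    show "optimal_value T loss j \<le> (INF v\<in>X j. ?g v)"
      using decisions_nonempty[OF j] upper by (rule cINF_greatest)
    \<comment> \<open>The optimal value at \<open>j\<close> itself serves as the lower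
      bound.\<close>
    have "bdd_below (?g ` X j)" using upper by (rule bdd_belowI2)
    then have "(INF v\<in>X j. ?g v) \<le> ?F y j" if "y \<in> ?P j" for y
      using lower[OF that] that self_in_subtree by (intro cINF_lower2[of _ _ "y j"]) auto
    then show "(INF v\<in>X j. ?g v) \<le> optimal_value T loss j"
      unfolding optimal_value_def using PiE_subtree_nonempty[OF j] by (intro cINF_greatest)
  qed
qed

section \<open>From optimal values to regrets\<close>

text \<open>The realised values of the children occur both in the local losses and in the regrets.
  They cancel, leaving the Bellman objective, which no longer depends on \<open>x\<close>.\<close>

lemma sum_local_loss_minus_regret:
  "(\<Sum>t=1..T. local_loss (loss t) (x t) j v)
     - (\<Sum>a\<in>A j. \<Sum>k\<in>C j a. v $ a * subtree_regret T loss x k) =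
   (\<Sum>t=1..T. loss t j v) + (\<Sum>a\<in>A j. \<Sum>k\<in>C j a. v $ a * optimal_value T loss k)"
proof -
  have "(\<Sum>t=1..T. \<Sum>a\<in>A j. \<Sum>k\<in>C j a. v $ a * subtree_value (loss t) (x t) k) =
      (\<Sum>a\<in>A j. \<Sum>t=1..T. \<Sum>k\<in>C j a. v $ a * subtree_value (loss t) (x t) k)"
    by (rule sum.swap)
  also have "\<dots> = (\<Sum>a\<in>A j. \<Sum>k\<in>C j a. \<Sum>t=1..T. v $ a * subtree_value (loss t) (x t) k)"
    by (intro sum.cong refl sum.swap)
  finally show ?thesis
    by (simp add: local_loss_def subtree_regret_def optimal_value_def sum.distrib
        right_diff_distrib sum_subtractf sum_distrib_left)
qed

lemma subtree_regret_decomposition: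
  assumes "\<And>t i. t \<in> {1..T} \<Longrightarrow> i \<in> J \<Longrightarrow> bdd_below (loss t i ` X i)" "j \<in> J"
  shows "subtree_regret T loss x j =
    (\<Sum>t=1..T. local_loss (loss t) (x t) j (x t j))
    - (INF v\<in>X j. (\<Sum>t=1..T. local_loss (loss t) (x t) j v)
        - (\<Sum>a\<in>A j. \<Sum>k\<in>C j a. v $ a * subtree_regret T loss x k))"
proof -
  have "subtree_regret T loss x j =
      (\<Sum>t=1..T. local_loss (loss t) (x t) j (x t j)) - optimal_value T loss j"
    by (simp add: subtree_regret_def optimal_value_def subtree_value_unfold[OF assms(2)])
  then show ?thesis
    by (simp only: sum_local_loss_minus_regret optimal_value_recursion[OF assms])
qed

end

theorem theorem1:
  fixes J :: "'j set"
    and r :: 'j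
    and A :: "'j \<Rightarrow> 'a::finite set"
    and C :: "'j \<Rightarrow> 'a \<Rightarrow> 'j set"
    and X :: "'j \<Rightarrow> (real ^ 'a) set"
    and T :: nat
    and x :: "nat \<Rightarrow> 'j \<Rightarrow> real ^ 'a"
    and loss :: "nat \<Rightarrow> 'j \<Rightarrow> real ^ 'a \<Rightarrow> real"
    and j :: 'j
  assumes "sdp J r A C X"
    and "T \<ge> 1"
    and "\<And>t. t \<in> {1..T} \<Longrightarrow> x t \<in> (\<Pi>\<^sub>E i\<in>J. X i)"
    and "\<And>t i. t \<in> {1..T} \<Longrightarrow> i \<in> J \<Longrightarrow> convex_on (X i) (loss t i)"
    and "j \<in> J"
  shows "sdp.subtree_regret J A C X T loss x j =
    (\<Sum>t=1..T. sdp.local_loss J A C (loss t) (x t) j (x t j))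
    - (INF v\<in>X j. (\<Sum>t=1..T. sdp.local_loss J A C (loss t) (x t) j v)
        - (\<Sum>a\<in>A j. \<Sum>k\<in>C j a. v $ a * sdp.subtree_regret J A C X T loss x k))"
proof (rule sdp.subtree_regret_decomposition[OF assms(1) _ assms(5)])
  fix t i assume "t \<in> {1..T}" "i \<in> J"
  then show "bdd_below (loss t i ` X i)"
    using assms(4) sdp.decisions_compact[OF assms(1)] compact_imp_bounded
    by (intro convex_on_bounded_imp_bdd_below) auto
qed

end
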